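(* Let $t_0\in\mathbb{R}$ and let $r>0$ be finite and fixed. Let $A(t)=\sum_{n=0}^\infty A_n(t-t_0)^n$ and $B(t)=\sum_{n=0}^\infty B_n(t-t_0)^n$ be two random power series in the $\mathrm{L}^\infty(\Omega)$ setting, for $t\in(t_0-r,t_0+r)$, and let $Y_0,Y_1\in\mathrm{L}^2(\Omega)$. Suppose that $Y_0$ is absolutely continuous with density function $f_{Y_0}$ and is independent of $(Y_1,A_0,A_1,\ldots,B_0,B_1,\ldots)$. If $f_{Y_0}$ is continuous on $\mathbb{R}$ and $f_{Y_0}(y)\le\alpha+\beta y^2$ for all $y\in\mathbb{R}$, for certain constants $\alpha,\beta\ge0$, then $$\lim_{N\to\infty}f_{X^N(t)}(x)=f_{X(t)}(x)$$ for each $t\in(t_0-\delta,t_0+\delta)$ and for every $x\in\mathbb{R}$.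
   Context: $(\Omega,\mathcal{F},\mathbb{P})$ is a complete probability space; $\mathrm{L}^p(\Omega)$ is the Lebesgue space of real random variables with norm $\|\cdot\|_p$. A random power series $\sum_n A_n(t-t_0)^n$ is "in the $\mathrm{L}^\infty(\Omega)$ setting for $t\in(t_0-r,t_0+r)$" if $A_n\in\mathrm{L}^\infty(\Omega)$ for all $n$ and for every such $t$ the series converges in $\mathrm{L}^\infty(\Omega)$. $S_0(t)=\sum_{n\ge0}S_{0,n}(t-t_0)^n$ and $S_1(t)=\sum_{n\ge0}S_{1,n}(t-t_0)^n$ are the random power series, convergent in $\mathrm{L}^\infty(\Omega)$ for $t\in(t_0-r,t_0+r)$, with $S_{0,0}=1$, $S_{0,1}=0$, $S_{1,0}=0$, $S_{1,1}=1$ and, for $i\in\{0,1\}$ and $n\ge0$, $S_{i,n+2}=\frac{-1}{(n+2)(n+1)}\sum_{m=0}^n[(m+1)A_{n-m}S_{i,m+1}+B_{n-m}S_{i,m}]$. The process $X(t)=Y_0S_0(t)+Y_1S_1(t)$ is the mean square solution of $\ddot X+A\dot X+BX=0$, $X(t_0)=Y_0$, $\dot X(t_0)=Y_1$. $S_i^N(t)=\sum_{n=0}^NS_{i,n}(t-t_0)^n$ are the partial sums, and $X^N(t)=Y_0S_0^N(t)+Y_1S_1^N(t)$. $\delta\in(0,r]$ is a number such that $\|S_0(t)-1\|_\infty<1/4$ for all $t\in(t_0-\delta,t_0+\delta)$ (it exists since $S_0(t_0)=1$ and $S_0$ is continuous in $\mathrm{L}^\infty(\Omega)$); hence $S_0(t)>3/4$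 almost surely there. For $t\in(t_0-\delta,t_0+\delta)$, $N_t$ is a positive integer such that $\|S_0^N(t)-S_0(t)\|_\infty<1/4$ for all $N\ge N_t$, so that $S_0^N(t)>1/2$ almost surely for $N\ge N_t$. The densities of $X(t)$ and of $X^N(t)$ ($N\ge N_t$) are the functions $$f_{X(t)}(x)=\mathbb{E}\left[f_{Y_0}\left(\tfrac{x-Y_1S_1(t)}{S_0(t)}\right)\tfrac{1}{|S_0(t)|}\right],\qquad f_{X^N(t)}(x)=\mathbb{E}\left[f_{Y_0}\left(\tfrac{x-Y_1S_1^N(t)}{S_0^N(t)}\right)\tfrac{1}{|S_0^N(t)|}\right].$$ *)

theory Defs
  imports "HOL-Probability.Probability" "HOL-Probability.Essential_Supremum"
begin

text \<open>Random variables are real functions on the probability space \<open>M\<close>, not equivalence classes.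
  The norm of \<open>L\<^sup>\<infinity>\<close> is extended-real valued, so that it is defined for every function.\<close>

definition Linf_norm :: "'a measure \<Rightarrow> ('a \<Rightarrow> real) \<Rightarrow> ereal" where
  "Linf_norm M f = esssup M (\<lambda>\<omega>. ereal \<bar>f \<omega>\<bar>)"

definition Linf :: "'a measure \<Rightarrow> ('a \<Rightarrow> real) set" where
  "Linf M = {f \<in> borel_measurable M. Linf_norm M f < \<infinity>}"

definition L2 :: "'a measure \<Rightarrow> ('a \<Rightarrow> real) set" where
  "L2 M = {f \<in> borel_measurable M. integrable M (\<lambda>\<omega>. (f \<omega>)\<^sup>2)}"

definition Linf_sums :: "'a measure \<Rightarrow> (nat \<Rightarrow> 'a \<Rightarrow> real) \<Rightarrow> ('a \<Rightarrow> real) \<Rightarrow> bool" where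
  "Linf_sums M f s \<longleftrightarrow> s \<in> Linf M \<and>
     (\<lambda>N. Linf_norm M (\<lambda>\<omega>. (\<Sum>n=0..N. f n \<omega>) - s \<omega>)) \<longlonglongrightarrow> 0"

definition Linf_summable :: "'a measure \<Rightarrow> (nat \<Rightarrow> 'a \<Rightarrow> real) \<Rightarrow> bool" where
  "Linf_summable M f \<longleftrightarrow> (\<exists>s. Linf_sums M f s)"

text \<open>The sum of a series in \<open>L\<^sup>\<infinity>\<close> is determined only up to almost sure equality;
  \<open>Linf_suminf\<close> selects a representative (and is unspecified if the series does not converge).\<close>

definition Linf_suminf :: "'a measure \<Rightarrow> (nat \<Rightarrow> 'a \<Rightarrow> real) \<Rightarrow> 'a \<Rightarrow> real" where
  "Linf_suminf M f = (SOME s. Linf_sums M f s)"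

definition Linf_power_series :: "'a measure \<Rightarrow> (nat \<Rightarrow> 'a \<Rightarrow> real) \<Rightarrow> real \<Rightarrow> real \<Rightarrow> bool" where
  "Linf_power_series M A t0 r \<longleftrightarrow> (\<forall>n. A n \<in> Linf M) \<and>
     (\<forall>t\<in>{t0 - r<..<t0 + r}. Linf_summable M (\<lambda>n \<omega>. A n \<omega> * (t - t0) ^ n))"

text \<open>The coefficients \<open>S\<^sub>i\<^sub>,\<^sub>n\<close> of the power series solution of \<open>X'' + A X' + B X = 0\<close> with
  deterministic initial coefficients: \<open>(c0, c1) = (1, 0)\<close> for \<open>i = 0\<close> and \<open>(0, 1)\<close> for \<open>i = 1\<close>.\<close>

context
  notes sum.cong [fundef_cong]
begin

fun S_coeff :: "(nat \<Rightarrow> 'a \<Rightarrow> real) \<Rightarrow> (nat \<Rightarrow> 'a \<Rightarrow> real) \<Rightarrow> real \<Rightarrow> real \<Rightarrow> nat \<Rightarrow> 'a \<Rightarrow> real" where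
  "S_coeff A B c0 c1 0 \<omega> = c0"
| "S_coeff A B c0 c1 (Suc 0) \<omega> = c1"
| "S_coeff A B c0 c1 (Suc (Suc n)) \<omega> =
     - 1 / (real (n + 2) * real (n + 1)) *
     (\<Sum>m=0..n. real (m + 1) * A (n - m) \<omega> * S_coeff A B c0 c1 (m + 1) \<omega>
              + B (n - m) \<omega> * S_coeff A B c0 c1 m \<omega>)"

end

definition S_partial ::
  "(nat \<Rightarrow> 'a \<Rightarrow> real) \<Rightarrow> (nat \<Rightarrow> 'a \<Rightarrow> real) \<Rightarrow> real \<Rightarrow> real \<Rightarrow> real \<Rightarrow> nat \<Rightarrow> real \<Rightarrow> 'a \<Rightarrow> real" where
  "S_partial A B c0 c1 t0 N t \<omega> = (\<Sum>n=0..N. S_coeff A B c0 c1 n \<omega> * (t - t0) ^ n)"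

definition S_series ::
  "'a measure \<Rightarrow> (nat \<Rightarrow> 'a \<Rightarrow> real) \<Rightarrow> (nat \<Rightarrow> 'a \<Rightarrow> real) \<Rightarrow> real \<Rightarrow> real \<Rightarrow> real \<Rightarrow> real \<Rightarrow> 'a \<Rightarrow> real" where
  "S_series M A B c0 c1 t0 t = Linf_suminf M (\<lambda>n \<omega>. S_coeff A B c0 c1 n \<omega> * (t - t0) ^ n)"

text \<open>The library's \<open>indep_var\<close> requires both random variables to take values in the same type;
  this is the property in \<open>prob_space.indep_var_eq\<close> for arbitrary value types.\<close>

definition indep_rv :: "'a measure \<Rightarrow> 'b measure \<Rightarrow> ('a \<Rightarrow> 'b) \<Rightarrow> 'c measure \<Rightarrow> ('a \<Rightarrow> 'c) \<Rightarrow> bool" where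
  "indep_rv M S X T Y \<longleftrightarrow> X \<in> measurable M S \<and> Y \<in> measurable M T \<and>
     prob_space.indep_set M
       (sigma_sets (space M) {X -` E \<inter> space M | E. E \<in> sets S})
       (sigma_sets (space M) {Y -` E \<inter> space M | E. E \<in> sets T})"

text \<open>The density at \<open>x\<close> of \<open>Y\<^sub>0 s\<^sub>0 + Y\<^sub>1 s\<^sub>1\<close>, where \<open>g\<close> is the density of \<open>Y\<^sub>0\<close>,
  \<open>Y\<^sub>0\<close> is independent of \<open>(Y\<^sub>1, s\<^sub>0, s\<^sub>1)\<close> and \<open>s\<^sub>0 \<noteq> 0\<close> almost surely. Changing \<open>s\<^sub>0\<close> or \<open>s\<^sub>1\<close>
  on a null set does not affect it.\<close>

definition lin_comb_density ::
  "'a measure \<Rightarrow> (real \<Rightarrow> real) \<Rightarrow> ('a \<Rightarrow> real) \<Rightarrow> ('a \<Rightarrow> real) \<Rightarrow> ('a \<Rightarrow> real) \<Rightarrow> real \<Rightarrow> real" where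
  "lin_comb_density M g Y1 s0 s1 x =
     integral\<^sup>L M (\<lambda>\<omega>. g ((x - Y1 \<omega> * s1 \<omega>) / s0 \<omega>) * (1 / \<bar>s0 \<omega>\<bar>))"

definition density_X ::
  "'a measure \<Rightarrow> (nat \<Rightarrow> 'a \<Rightarrow> real) \<Rightarrow> (nat \<Rightarrow> 'a \<Rightarrow> real) \<Rightarrow> (real \<Rightarrow> real) \<Rightarrow> ('a \<Rightarrow> real) \<Rightarrow>
     real \<Rightarrow> real \<Rightarrow> real \<Rightarrow> real" where
  "density_X M A B g Y1 t0 t =
     lin_comb_density M g Y1 (S_series M A B 1 0 t0 t) (S_series M A B 0 1 t0 t)"

definition density_XN ::
  "'a measure \<Rightarrow> (nat \<Rightarrow> 'a \<Rightarrow> real) \<Rightarrow> (nat \<Rightarrow> 'a \<Rightarrow> real) \<Rightarrow> (real \<Rightarrow> real) \<Rightarrow> ('a \<Rightarrow> real) \<Rightarrow>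
     real \<Rightarrow> nat \<Rightarrow> real \<Rightarrow> real \<Rightarrow> real" where
  "density_XN M A B g Y1 t0 N t =
     lin_comb_density M g Y1 (S_partial A B 1 0 t0 N t) (S_partial A B 0 1 t0 N t)"

end

theory Submission
  imports Defs
begin

text \<open>
  The density of \<open>Y\<^sub>0 s\<^sub>0 + Y\<^sub>1 s\<^sub>1\<close> at a point is the expectation of a continuous function of
  \<open>s\<^sub>0\<close> and \<open>s\<^sub>1\<close>, so dominated convergence gives the limit, provided that the partial sums converge
  almost surely, that \<open>\<bar>s\<^sub>0\<bar>\<close> stays away from \<open>0\<close> and that \<open>\<bar>s\<^sub>1\<bar>\<close> stays bounded. The growth condition
  on the density of \<open>Y\<^sub>0\<close> then turns into a dominating function that is affine in \<open>Y\<^sub>1\<^sup>2\<close>, which is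
  integrable because \<open>Y\<^sub>1\<close> is in \<open>L\<^sup>2\<close> (lemma \<open>lin_comb_density_tendsto\<close>). The two bounds
  come from the hypothesis \<open>\<parallel>S\<^sub>0(t) - 1\<parallel> < 1/4\<close> and from the essential boundedness of \<open>S\<^sub>1(t)\<close>, both
  transferred to the partial sums of large index.

  What has to be proved is thus that the series \<open>S\<^sub>0\<close> and \<open>S\<^sub>1\<close> do converge in \<open>L\<^sup>\<infinity>\<close>
  (lemma \<open>Linf_sums_S_series\<close>): only then is \<open>S_series\<close> their sum rather than an arbitrary choice.
  This is the Fuchs--Frobenius theorem with random coefficients, and it reduces to the deterministic
  one. Convergence of the series of \<open>A\<close> and \<open>B\<close> at distance \<open>s < r\<close> from \<open>t\<^sub>0\<close> gives a
  constant \<open>C\<close> with \<open>\<bar>A\<^sub>n\<bar>, \<bar>B\<^sub>n\<bar> \<le> C s\<^bsup>-n\<^esup>\<close> almost surely for all \<open>n\<close> at once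
  (lemma \<open>Linf_power_series_coeff_bound\<close>). Pathwise, the recurrence then bounds the solution
  coefficients by \<open>K u\<^bsup>-n\<^esup>\<close> for every \<open>u < s\<close>, with \<open>K\<close> depending on \<open>C\<close>, \<open>s\<close> and \<open>u\<close> but not
  on the path (lemma \<open>S_coeff_growth_bound\<close>). So the series is dominated, almost surely, by one
  geometric series, and its tails are uniformly small.
\<close>

section \<open>Convergence in \<open>L\<^sup>\<infinity>\<close> as almost sure uniform convergence\<close>

lemma Linf_norm_leI:
  assumes "f \<in> borel_measurable M" "AE \<omega> in M. \<bar>f \<omega>\<bar> \<le> c"
  shows "Linf_norm M f \<le> ereal c"
  unfolding Linf_norm_def using assms by (intro esssup_I) auto

lemma AE_le_of_Linf_norm_le:
  assumes "Linf_norm M f \<le> ereal c"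
  shows "AE \<omega> in M. \<bar>f \<omega>\<bar> \<le> c"
  using esssup_AE[of "\<lambda>\<omega>. ereal \<bar>f \<omega>\<bar>" M]
proof eventually_elim
  case (elim \<omega>)
  then have "ereal \<bar>f \<omega>\<bar> \<le> ereal c"
    using assms unfolding Linf_norm_def by (rule order_trans)
  then show ?case by simp
qed

text \<open>On a null space the essential supremum of any measurable function is \<open>-\<infinity>\<close>, so the total mass matters here.\<close>

lemma Linf_norm_nonneg:
  assumes "prob_space M"
  shows "0 \<le> Linf_norm M f"
proof -
  interpret prob_space M by fact
  have "esssup M (\<lambda>_. 0::ereal) \<le> esssup M (\<lambda>\<omega>. ereal \<bar>f \<omega>\<bar>)"
    by (intro esssup_mono) auto
  then show ?thesis
    by (simp add: Linf_norm_def esssup_const emeasure_space_1)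
qed

lemma Linf_bounded:
  assumes "f \<in> Linf M"
  obtains c where "AE \<omega> in M. \<bar>f \<omega>\<bar> \<le> c"
proof -
  have "Linf_norm M f < \<infinity>" using assms by (simp add: Linf_def)
  then obtain c where "Linf_norm M f \<le> ereal c"
    by (metis ereal_dense2 less_imp_le)
  then show thesis by (intro that AE_le_of_Linf_norm_le)
qed

lemma LinfI:
  assumes "f \<in> borel_measurable M" "AE \<omega> in M. \<bar>f \<omega>\<bar> \<le> c"
  shows "f \<in> Linf M"
  using Linf_norm_leI[OF assms] assms(1) by (auto simp: Linf_def intro: le_less_trans)

text \<open>All later arguments are pathwise, so \<open>L\<^sup>\<infinity>\<close> convergence is used only in this form: a norm below
  \<open>e\<close> is an almost sure bound for each index, and countably many exceptional null sets
  can be merged into one that serves every index.\<close>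

lemma Linf_sums_iff_uniform_AE:
  assumes M: "prob_space M" and f [measurable]: "\<And>n. f n \<in> borel_measurable M"
  shows "Linf_sums M f s \<longleftrightarrow> s \<in> Linf M \<and>
    (\<forall>e>0. \<exists>N0. AE \<omega> in M. \<forall>N\<ge>N0. \<bar>(\<Sum>n=0..N. f n \<omega>) - s \<omega>\<bar> \<le> e)"
    (is "_ \<longleftrightarrow> _ \<and> ?unif")
proof (cases "s \<in> Linf M")
  case True
  then have [measurable]: "s \<in> borel_measurable M" by (simp add: Linf_def)
  let ?d = "\<lambda>N. Linf_norm M (\<lambda>\<omega>. (\<Sum>n=0..N. f n \<omega>) - s \<omega>)"
  have "?d \<longlonglongrightarrow> 0 \<longleftrightarrow> ?unif"
  proof
    assume lim: "?d \<longlonglongrightarrow> 0"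
    show ?unif
    proof (intro allI impI)
      fix e :: real assume "e > 0"
      then have "eventually (\<lambda>N. ?d N < ereal e) sequentially"
        by (intro order_tendstoD(2)[OF lim]) simp
      then obtain N0 where N0: "\<And>N. N \<ge> N0 \<Longrightarrow> ?d N < ereal e"
        by (auto simp: eventually_sequentially)
      have "AE \<omega> in M. N \<ge> N0 \<longrightarrow> \<bar>(\<Sum>n=0..N. f n \<omega>) - s \<omega>\<bar> \<le> e" for N
        using AE_le_of_Linf_norm_le[OF less_imp_le[OF N0[of N]]] by (cases "N \<ge> N0") auto
      then show "\<exists>N0. AE \<omega> in M. \<forall>N\<ge>N0. \<bar>(\<Sum>n=0..N. f n \<omega>) - s \<omega>\<bar> \<le> e"
        by (intro exI[of _ N0]) (simp add: AE_all_countable)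
    qed
  next
    assume unif: ?unif
    show "?d \<longlonglongrightarrow> 0"
    proof (rule order_tendstoI)
      fix a :: ereal assume "a < 0"
      then show "eventually (\<lambda>N. a < ?d N) sequentially"
        using Linf_norm_nonneg[OF M] by (intro always_eventually allI) (rule less_le_trans)
    next
      fix a :: ereal assume "0 < a"
      then obtain e where e: "0 < ereal e" "ereal e < a" by (metis ereal_dense2)
      then obtain N0 where N0: "AE \<omega> in M. \<forall>N\<ge>N0. \<bar>(\<Sum>n=0..N. f n \<omega>) - s \<omega>\<bar> \<le> e"
        using unif by auto
      have "?d N \<le> ereal e" if "N \<ge> N0" for N
        by (rule Linf_norm_leI) (use N0 that in auto)
      then show "eventually (\<lambda>N. ?d N < a) sequentially"
        unfolding eventually_sequentially using e(2) le_less_trans by blast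
    qed
  qed
  then show ?thesis using True by (simp add: Linf_sums_def)
qed (simp add: Linf_sums_def)

lemma Linf_sums_imp_AE_tendsto:
  assumes "prob_space M" "\<And>n. f n \<in> borel_measurable M" "Linf_sums M f s"
  shows "AE \<omega> in M. (\<lambda>N. \<Sum>n=0..N. f n \<omega>) \<longlonglongrightarrow> s \<omega>"
proof -
  have "\<exists>N0. AE \<omega> in M. \<forall>N\<ge>N0. \<bar>(\<Sum>n=0..N. f n \<omega>) - s \<omega>\<bar> \<le> inverse (real (Suc k))" for k
    using Linf_sums_iff_uniform_AE[where s = s, OF assms(1,2)] assms(3) by auto
  then have "\<forall>k. AE \<omega> in M. \<exists>N0. \<forall>N\<ge>N0. \<bar>(\<Sum>n=0..N. f n \<omega>) - s \<omega>\<bar> \<le> inverse (real (Suc k))"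
    by (fastforce elim: eventually_mono)
  then have "AE \<omega> in M. \<forall>k. \<exists>N0. \<forall>N\<ge>N0. \<bar>(\<Sum>n=0..N. f n \<omega>) - s \<omega>\<bar> \<le> inverse (real (Suc k))"
    by (simp add: AE_all_countable)
  then show ?thesis
  proof eventually_elim
    case (elim \<omega>)
    show ?case
    proof (rule LIMSEQ_I)
      fix e :: real assume "e > 0"
      then obtain k where k: "inverse (real (Suc k)) < e" using reals_Archimedean by blast
      from elim obtain N0 where
        "\<forall>N\<ge>N0. \<bar>(\<Sum>n=0..N. f n \<omega>) - s \<omega>\<bar> \<le> inverse (real (Suc k))" by blast
      with k show "\<exists>N0. \<forall>N\<ge>N0. norm ((\<Sum>n=0..N. f n \<omega>) - s \<omega>) < e"
        by (auto intro: le_less_trans)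
    qed
  qed
qed

section \<open>Coefficients of the power series\<close>

text \<open>Cauchy's estimate in the form needed for random series. The partial sums at \<open>t\<^sub>0 + s\<close> are within
  \<open>1\<close> of their limit from some index on, hence consecutive ones differ by at most \<open>2\<close>; the
  finitely many earlier coefficients are bounded individually.\<close>

lemma Linf_power_series_coeff_bound:
  assumes M: "prob_space M" and A: "Linf_power_series M A t0 r" and s: "0 < s" "s < r"
  obtains C where "AE \<omega> in M. \<forall>n. \<bar>A n \<omega>\<bar> \<le> C * (1 / s) ^ n"
proof -
  define f where "f n \<omega> = A n \<omega> * s ^ n" for n \<omega>
  have Alinf: "A n \<in> Linf M" for n using A by (auto simp: Linf_power_series_def)
  then have [measurable]: "A n \<in> borel_measurable M" for n by (simp add: Linf_def)
  have fm [measurable]: "f n \<in> borel_measurable M" for n unfolding f_def by measurable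
  have "t0 + s \<in> {t0 - r<..<t0 + r}" using s by auto
  then have "Linf_summable M (\<lambda>n \<omega>. A n \<omega> * (t0 + s - t0) ^ n)"
    using A unfolding Linf_power_series_def by blast
  then obtain S where "Linf_sums M f S"
    by (auto simp: Linf_summable_def f_def[abs_def])
  then obtain N0 where N0: "AE \<omega> in M. \<forall>N\<ge>N0. \<bar>(\<Sum>n=0..N. f n \<omega>) - S \<omega>\<bar> \<le> 1"
    using Linf_sums_iff_uniform_AE[where s = S and f = f, OF M fm] by (auto dest: spec[of _ 1])
  have "\<exists>c. AE \<omega> in M. \<bar>A n \<omega>\<bar> \<le> c" for n using Linf_bounded[OF Alinf] by metis
  then obtain c where c: "\<And>n. AE \<omega> in M. \<bar>A n \<omega>\<bar> \<le> c n" by metis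
  define C where "C = 2 + (\<Sum>n\<le>N0. \<bar>c n\<bar> * s ^ n)"
  have "AE \<omega> in M. \<forall>n. \<bar>A n \<omega>\<bar> \<le> c n" using c by (simp add: AE_all_countable)
  with N0 have "AE \<omega> in M. \<forall>n. \<bar>A n \<omega>\<bar> \<le> C * (1 / s) ^ n"
  proof eventually_elim
    case (elim \<omega>)
    have "\<bar>A n \<omega>\<bar> * s ^ n \<le> C" for n
    proof (cases "n \<le> N0")
      case True
      have "\<bar>A n \<omega>\<bar> * s ^ n \<le> \<bar>c n\<bar> * s ^ n"
        using elim(2) s by (intro mult_right_mono) (auto intro: order_trans)
      also have "\<dots> \<le> (\<Sum>n\<le>N0. \<bar>c n\<bar> * s ^ n)"
        by (rule member_le_sum[where f = "\<lambda>n. \<bar>c n\<bar> * s ^ n"]) (use True s in auto)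
      finally show ?thesis by (simp add: C_def)
    next
      case False
      then obtain k where k: "n = Suc k" "k \<ge> N0" by (cases n) auto
      have "\<bar>(\<Sum>n=0..k. f n \<omega>) - S \<omega>\<bar> \<le> 1" "\<bar>(\<Sum>n=0..Suc k. f n \<omega>) - S \<omega>\<bar> \<le> 1"
        using elim(1) k(2) by (blast, metis le_SucI)
      then have "\<bar>f n \<omega>\<bar> \<le> 2" by (auto simp: k(1))
      moreover have "0 \<le> (\<Sum>n\<le>N0. \<bar>c n\<bar> * s ^ n)" using s by (intro sum_nonneg) auto
      ultimately show ?thesis using s by (simp add: C_def f_def abs_mult)
    qed
    then show ?case using s by (simp add: field_simps)
  qed
  then show thesis by (rule that)
qed

text \<open>The majorant for a single path. If each coefficient of index \<open>m \<le> k + 1\<close> is at most \<open>W l\<^bsup>m\<^esup>\<close> in modulus, then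
  the convolution with the geometric bounds of ratio \<open>q < l\<close> shows that the one of index \<open>k + 2\<close> is at
  most \<open>W l\<^bsup>k+2\<^esup>\<close> times \<open>D / (k + 2)\<close>, where \<open>D = C (l + 1) / (l (l - q))\<close>; the division by \<open>k + 2\<close> is what
  remains of the prefactor \<open>1 / ((k + 2) (k + 1))\<close> after cancelling the weights \<open>m + 1 \<le> k + 1\<close>.
  From index \<open>p \<ge> D\<close> on this factor is at most \<open>1\<close>, so it can enlarge the bound
  only finitely often, which is recorded by the factor \<open>p\<^bsup>min n p\<^esup>\<close>. The constants do not depend on
  \<open>\<omega>\<close>.\<close>

lemma S_coeff_growth_bound:
  fixes A B :: "nat \<Rightarrow> 'a \<Rightarrow> real" and q l C c0 c1 :: real and p :: nat
  assumes A: "\<And>n. \<bar>A n \<omega>\<bar> \<le> C * q ^ n" and B: "\<And>n. \<bar>B n \<omega>\<bar> \<le> C * q ^ n"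
    and q: "0 < q" "q < l" and p: "1 \<le> p" "C * (l + 1) / (l * (l - q)) \<le> real p"
  shows "\<bar>S_coeff A B c0 c1 n \<omega>\<bar> \<le> (\<bar>c0\<bar> + \<bar>c1\<bar> / l) * l ^ n * real p ^ min n p"
proof (induction n rule: less_induct)
  case (less n)
  have l: "l > 0" using q by simp
  have C: "C \<ge> 0" using A[of 0] by simp
  define K where "K = \<bar>c0\<bar> + \<bar>c1\<bar> / l"
  have K: "K \<ge> 0" using l by (simp add: K_def)
  define w where "w n = real p ^ min n p" for n
  have w0: "w n > 0" for n using p by (simp add: w_def)
  have wmono: "w m \<le> w n" if "m \<le> n" for m n
    using p that unfolding w_def by (intro power_increasing) auto
  have IH: "\<bar>S_coeff A B c0 c1 m \<omega>\<bar> \<le> K * l ^ m * w m" if "m < n" for m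
    using less[OF that] by (simp add: K_def w_def)
  consider "n = 0" | "n = Suc 0" | k where "n = Suc (Suc k)" by (metis not0_implies_Suc)
  then have "\<bar>S_coeff A B c0 c1 n \<omega>\<bar> \<le> K * l ^ n * w n"
  proof cases
    case 1
    then show ?thesis using l by (simp add: K_def w_def)
  next
    case 2
    have "\<bar>c1\<bar> \<le> K * l" using l by (simp add: K_def field_simps)
    also have "\<dots> \<le> K * l * w 1" using mult_left_mono[OF wmono[of 0 1], of "K * l"] K l by (auto simp: w_def)
    finally show ?thesis using 2 by simp
  next
    case 3
    let ?S = "\<lambda>m. S_coeff A B c0 c1 m \<omega>"
    let ?g = "\<lambda>m. real (m + 1) * A (k - m) \<omega> * ?S (m + 1) + B (k - m) \<omega> * ?S m"
    let ?W = "real (k + 1) * C * K * w (Suc k) * (l + 1)"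
    have W0: "?W \<ge> 0" using C K l less_imp_le[OF w0] by simp
    have bd: "\<bar>?S m\<bar> \<le> K * l ^ m * w (Suc k)" if "m \<le> Suc k" for m
      using order_trans[OF IH mult_left_mono[OF wmono[of m "Suc k"]]] that 3 K l by simp
    have term_bound: "\<bar>?g m\<bar> \<le> ?W * (l ^ m * q ^ (k - m))" if "m \<le> k" for m
    proof -
      have "\<bar>?g m\<bar> \<le> real (m + 1) * \<bar>A (k - m) \<omega>\<bar> * \<bar>?S (m + 1)\<bar> + 1 * \<bar>B (k - m) \<omega>\<bar> * \<bar>?S m\<bar>"
        by (rule order_trans[OF abs_triangle_ineq]) (simp add: abs_mult)
      also have "\<dots> \<le> real (k + 1) * (C * q ^ (k - m)) * (K * l ^ (m + 1) * w (Suc k))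
                    + real (k + 1) * (C * q ^ (k - m)) * (K * l ^ m * w (Suc k))"
        using that q C by (intro add_mono mult_mono A B bd) auto
      also have "\<dots> = ?W * (l ^ m * q ^ (k - m))" by (simp add: algebra_simps)
      finally show ?thesis .
    qed
    have geom: "(\<Sum>m=0..k. l ^ m * q ^ (k - m)) \<le> l ^ Suc k / (l - q)"
    proof -
      have "(l - q) * (\<Sum>m=0..k. l ^ m * q ^ (k - m)) = l ^ Suc k - q ^ Suc k"
        using diff_power_eq_sum[of l k q] by (simp add: atLeast0AtMost lessThan_Suc_atMost)
      also have "\<dots> \<le> l ^ Suc k" using q by simp
      finally show ?thesis using q by (simp add: field_simps)
    qed
    have "\<bar>\<Sum>m=0..k. ?g m\<bar> \<le> (\<Sum>m=0..k. ?W * (l ^ m * q ^ (k - m)))"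
      by (rule order_trans[OF sum_abs sum_mono]) (use term_bound in auto)
    also have "\<dots> \<le> ?W * (l ^ Suc k / (l - q))"
      unfolding sum_distrib_left[symmetric] using geom W0 by (rule mult_left_mono)
    finally have "\<bar>?S n\<bar> \<le> 1 / (real (k + 2) * real (k + 1)) * (?W * (l ^ Suc k / (l - q)))"
      unfolding 3 S_coeff.simps abs_mult by (intro mult_mono) (auto simp: abs_mult)
    also have "\<dots> = K * l ^ n * w (Suc k) * ((C * (l + 1) / (l * (l - q))) / real (k + 2))"
      using l q unfolding 3 by (simp add: divide_simps)
    also have "\<dots> \<le> K * l ^ n * w (Suc k) * (real p / real (k + 2))"
      using p K l w0[of "Suc k"] by (intro mult_left_mono divide_right_mono) auto
    also have "\<dots> \<le> K * l ^ n * w n"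
    proof -
      have "w (Suc k) * (real p / real (k + 2)) \<le> w n"
      proof (cases "n \<le> p")
        case True
        then have "w n = w (Suc k) * real p" by (simp add: w_def 3 min_def)
        moreover have "w (Suc k) * real p * (1 / real (k + 2)) \<le> w (Suc k) * real p * 1"
          using w0[of "Suc k"] by (intro mult_left_mono) auto
        ultimately show ?thesis by simp
      next
        case False
        then have "real p / real (k + 2) \<le> 1" by (simp add: 3)
        then have "w (Suc k) * (real p / real (k + 2)) \<le> w (Suc k) * 1"
          using w0[of "Suc k"] by (intro mult_left_mono) auto
        also have "\<dots> \<le> w n" using wmono[of "Suc k" n] by (simp add: 3)
        finally show ?thesis .
      qed
      from mult_left_mono[OF this, of "K * l ^ n"] show ?thesis using K l by (simp add: mult_ac)
    qed
    finally show ?thesis .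
  qed
  then show ?case by (simp add: K_def w_def)
qed

lemma S_coeff_measurable [measurable]:
  assumes [measurable]: "\<And>n. A n \<in> borel_measurable M" "\<And>n. B n \<in> borel_measurable M"
  shows "S_coeff A B c0 c1 n \<in> borel_measurable M"
proof (induction n rule: less_induct)
  case (less n)
  consider "n = 0" | "n = Suc 0" | k where "n = Suc (Suc k)" by (metis not0_implies_Suc)
  then show ?case
  proof cases
    case 3
    have "(\<lambda>\<omega>. \<Sum>m=0..k. real (m + 1) * A (k - m) \<omega> * S_coeff A B c0 c1 (m + 1) \<omega>
              + B (k - m) \<omega> * S_coeff A B c0 c1 m \<omega>) \<in> borel_measurable M"
      using less 3 by (intro borel_measurable_sum borel_measurable_add borel_measurable_times) auto
    then show ?thesis unfolding 3 S_coeff.simps[abs_def] by measurable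
  qed simp_all
qed

section \<open>The solution series\<close>

text \<open>Between \<open>\<bar>t - t\<^sub>0\<bar>\<close> and \<open>r\<close> there is room for two radii \<open>u < s\<close>: the coefficients of \<open>A\<close> and \<open>B\<close> are
  controlled at radius \<open>s\<close>, those of the solution at the smaller radius \<open>u\<close>, and
  \<open>\<bar>t - t\<^sub>0\<bar> < u\<close> leaves a geometric series of ratio \<open>z < 1\<close>. The pathwise sum is then an \<open>L\<^sup>\<infinity>\<close>
  sum, and existence suffices since \<open>S_series\<close> selects some \<open>L\<^sup>\<infinity>\<close> sum.\<close>

lemma Linf_sums_S_series:
  fixes c0 c1 :: real
  assumes M: "prob_space M" and A: "Linf_power_series M A t0 r" and B: "Linf_power_series M B t0 r"
    and t: "\<bar>t - t0\<bar> < r"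
  shows "Linf_sums M (\<lambda>n \<omega>. S_coeff A B c0 c1 n \<omega> * (t - t0) ^ n) (S_series M A B c0 c1 t0 t)"
proof -
  define f where "f n \<omega> = S_coeff A B c0 c1 n \<omega> * (t - t0) ^ n" for n \<omega>
  have [measurable]: "A n \<in> borel_measurable M" "B n \<in> borel_measurable M" for n
    using A B by (auto simp: Linf_power_series_def Linf_def)
  have fm [measurable]: "f n \<in> borel_measurable M" for n unfolding f_def[abs_def] by measurable
  obtain u where u: "\<bar>t - t0\<bar> < u" "u < r" using dense[OF t] by blast
  obtain s where s: "u < s" "s < r" using dense[OF u(2)] by blast
  have pos: "0 < u" "0 < s" using u s by auto
  obtain CA where CA: "AE \<omega> in M. \<forall>n. \<bar>A n \<omega>\<bar> \<le> CA * (1 / s) ^ n"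
    using Linf_power_series_coeff_bound[OF M A pos(2) s(2)] .
  obtain CB where CB: "AE \<omega> in M. \<forall>n. \<bar>B n \<omega>\<bar> \<le> CB * (1 / s) ^ n"
    using Linf_power_series_coeff_bound[OF M B pos(2) s(2)] .
  define C where "C = max CA CB"
  obtain p0 :: nat where p0: "C * (1 / u + 1) / (1 / u * (1 / u - 1 / s)) \<le> real p0"
    using real_arch_simple by blast
  define p where "p = max 1 p0"
  define K where "K = (\<bar>c0\<bar> + \<bar>c1\<bar> / (1 / u)) * real p ^ p"
  define z where "z = \<bar>t - t0\<bar> / u"
  have z: "0 \<le> z" "z < 1" using u pos by (auto simp: z_def)
  have "AE \<omega> in M. \<forall>n. \<bar>f n \<omega>\<bar> \<le> K * z ^ n"
    using CA CB
  proof eventually_elim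
    case (elim \<omega>)
    have scale: "c * (1 / s) ^ n \<le> C * (1 / s) ^ n" if "c \<le> C" for c n
      using that pos by (intro mult_right_mono) auto
    have "\<bar>A n \<omega>\<bar> \<le> C * (1 / s) ^ n" "\<bar>B n \<omega>\<bar> \<le> C * (1 / s) ^ n" for n
      using elim scale[of CA n] scale[of CB n] unfolding C_def
      by (auto intro: order_trans)
    then have S: "\<bar>S_coeff A B c0 c1 n \<omega>\<bar>
        \<le> (\<bar>c0\<bar> + \<bar>c1\<bar> / (1 / u)) * (1 / u) ^ n * real p ^ min n p" for n
      by (rule S_coeff_growth_bound) (use pos s p0 in \<open>auto simp: p_def divide_strict_left_mono\<close>)
    show ?case
    proof
      fix n
      have "\<bar>S_coeff A B c0 c1 n \<omega>\<bar> \<le> K * (1 / u) ^ n"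
      proof (rule order_trans[OF S])
        have "(\<bar>c0\<bar> + \<bar>c1\<bar> / (1 / u)) * (1 / u) ^ n * real p ^ min n p
            \<le> (\<bar>c0\<bar> + \<bar>c1\<bar> / (1 / u)) * (1 / u) ^ n * real p ^ p"
          using pos by (intro mult_left_mono power_increasing) (auto simp: p_def)
        then show "(\<bar>c0\<bar> + \<bar>c1\<bar> / (1 / u)) * (1 / u) ^ n * real p ^ min n p \<le> K * (1 / u) ^ n"
          by (simp add: K_def mult_ac)
      qed
      then have "\<bar>S_coeff A B c0 c1 n \<omega>\<bar> * \<bar>t - t0\<bar> ^ n \<le> K * (1 / u) ^ n * \<bar>t - t0\<bar> ^ n"
        by (intro mult_right_mono) auto
      then show "\<bar>f n \<omega>\<bar> \<le> K * z ^ n"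
        by (simp add: f_def z_def abs_mult power_abs power_divide)
    qed
  qed
  then have bd: "AE \<omega> in M. \<forall>N. \<bar>(\<Sum>n=0..N. f n \<omega>) - (\<Sum>n. f n \<omega>)\<bar> \<le> K * z ^ Suc N / (1 - z)
      \<and> \<bar>\<Sum>n. f n \<omega>\<bar> \<le> K / (1 - z)"
  proof eventually_elim
    case (elim \<omega>)
    have geo: "(\<lambda>n. K * z ^ k * z ^ n) sums (K * z ^ k * (1 / (1 - z)))" for k
      using z by (intro sums_mult geometric_sums) simp
    have sm: "summable (\<lambda>n. f n \<omega>)"
      by (rule summable_comparison_test'[OF sums_summable[OF geo[of 0]], of 0]) (use elim in auto)
    have tail: "\<bar>\<Sum>n. f (n + k) \<omega>\<bar> \<le> K * z ^ k * (1 / (1 - z))" for k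
      unfolding sums_unique[OF geo] real_norm_def[symmetric]
    proof (rule norm_suminf_le)
      show "norm (f (n + k) \<omega>) \<le> K * z ^ k * z ^ n" for n
        using elim[rule_format, of "n + k"] by (simp add: power_add mult_ac)
      show "summable (\<lambda>n. K * z ^ k * z ^ n)" using geo by (rule sums_summable)
    qed
    show ?case
    proof
      fix N
      have "(\<Sum>n. f n \<omega>) = (\<Sum>n. f (n + Suc N) \<omega>) + (\<Sum>n=0..N. f n \<omega>)"
        using suminf_split_initial_segment[OF sm, of "Suc N"]
        by (simp add: atLeast0AtMost lessThan_Suc_atMost)
      then have "\<bar>(\<Sum>n=0..N. f n \<omega>) - (\<Sum>n. f n \<omega>)\<bar> \<le> K * z ^ Suc N / (1 - z)"
        using tail[of "Suc N"] by simp
      then show "\<bar>(\<Sum>n=0..N. f n \<omega>) - (\<Sum>n. f n \<omega>)\<bar> \<le> K * z ^ Suc N / (1 - z)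
          \<and> \<bar>\<Sum>n. f n \<omega>\<bar> \<le> K / (1 - z)"
        using tail[of 0] by simp
    qed
  qed
  have "Linf_sums M f (\<lambda>\<omega>. \<Sum>n. f n \<omega>)"
    unfolding Linf_sums_iff_uniform_AE[OF M fm]
  proof (intro conjI allI impI)
    show "(\<lambda>\<omega>. \<Sum>n. f n \<omega>) \<in> Linf M"
      by (rule LinfI[of _ _ "K / (1 - z)"], measurable) (use bd in \<open>auto elim: eventually_mono\<close>)
  next
    fix e :: real assume e: "e > 0"
    have "(\<lambda>N. z ^ Suc N) \<longlonglongrightarrow> 0"
      using z by (intro LIMSEQ_Suc LIMSEQ_power_zero) simp
    from tendsto_mult_left[OF this, of "K / (1 - z)"]
    have "(\<lambda>N. K * z ^ Suc N / (1 - z)) \<longlonglongrightarrow> 0" by (simp add: mult_ac)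
    from order_tendstoD(2)[OF this e] obtain N0
      where N0: "\<And>N. N \<ge> N0 \<Longrightarrow> K * z ^ Suc N / (1 - z) < e"
      by (auto simp: eventually_sequentially)
    from bd show "\<exists>N0. AE \<omega> in M. \<forall>N\<ge>N0. \<bar>(\<Sum>n=0..N. f n \<omega>) - (\<Sum>n. f n \<omega>)\<bar> \<le> e"
      by (intro exI[of _ N0], elim eventually_mono) (meson N0 less_imp_le order_trans)
  qed
  then have "Linf_sums M f (Linf_suminf M f)" unfolding Linf_suminf_def by (rule someI[of "Linf_sums M f"])
  then show ?thesis by (simp add: S_series_def f_def[abs_def])
qed

section \<open>Convergence of the densities\<close>

text \<open>With \<open>c \<le> \<bar>u\<^sub>N\<bar>\<close> and \<open>\<bar>v\<^sub>N\<bar> \<le> K\<close>, the square of the argument of \<open>g\<close> is at most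
  \<open>(2 x\<^sup>2 + 2 K\<^sup>2 Y\<^sup>2) / c\<^sup>2\<close>, so quadratic growth of \<open>g\<close> is exactly what a square integrable \<open>Y\<close>
  can absorb.\<close>

lemma lin_comb_density_tendsto:
  fixes g :: "real \<Rightarrow> real"
  assumes M: "finite_measure M" and Y: "Y \<in> L2 M" and g: "continuous_on UNIV g"
    and g0: "\<And>y. 0 \<le> g y" and gle: "\<And>y. g y \<le> \<alpha> + \<beta> * y\<^sup>2" and ab: "0 \<le> \<alpha>" "0 \<le> \<beta>"
    and um [measurable]: "u \<in> borel_measurable M" "\<And>N. uN N \<in> borel_measurable M"
    and vm [measurable]: "v \<in> borel_measurable M" "\<And>N. vN N \<in> borel_measurable M"
    and u: "AE \<omega> in M. (\<lambda>N. uN N \<omega>) \<longlonglongrightarrow> u \<omega>" and v: "AE \<omega> in M. (\<lambda>N. vN N \<omega>) \<longlonglongrightarrow> v \<omega>"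
    and c: "0 < c" "\<And>N. AE \<omega> in M. c \<le> \<bar>uN N \<omega>\<bar>" and K: "\<And>N. AE \<omega> in M. \<bar>vN N \<omega>\<bar> \<le> K"
  shows "(\<lambda>N. lin_comb_density M g Y (uN N) (vN N) x) \<longlonglongrightarrow> lin_comb_density M g Y u v x"
proof -
  interpret finite_measure M by fact
  have [measurable]: "Y \<in> borel_measurable M" and Y2: "integrable M (\<lambda>\<omega>. (Y \<omega>)\<^sup>2)"
    using Y by (auto simp: L2_def)
  have [measurable]: "g \<in> borel_measurable borel"
    by (rule borel_measurable_continuous_onI[OF g])
  define w where "w \<omega> = (\<alpha> + \<beta> * ((2 * x\<^sup>2 + 2 * K\<^sup>2 * (Y \<omega>)\<^sup>2) / c\<^sup>2)) * (1 / c)" for \<omega>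
  show ?thesis
    unfolding lin_comb_density_def
  proof (rule integral_dominated_convergence)
    show "integrable M w" unfolding w_def using Y2
      by (intro integrable_mult_left integrable_add integrable_mult_right
          integrable_divide integrable_const) auto
    have "AE \<omega> in M. \<forall>N. c \<le> \<bar>uN N \<omega>\<bar>" using c(2) by (simp add: AE_all_countable)
    with u v show "AE \<omega> in M. (\<lambda>N. g ((x - Y \<omega> * vN N \<omega>) / uN N \<omega>) * (1 / \<bar>uN N \<omega>\<bar>))
        \<longlonglongrightarrow> g ((x - Y \<omega> * v \<omega>) / u \<omega>) * (1 / \<bar>u \<omega>\<bar>)"
    proof eventually_elim
      case (elim \<omega>)
      have "c \<le> \<bar>u \<omega>\<bar>"
        by (rule tendsto_lowerbound[OF tendsto_rabs[OF elim(1)]]) (use elim(3) in auto)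
      then have "u \<omega> \<noteq> 0" using c(1) by auto
      moreover have "isCont g y" for y using g by (simp add: continuous_on_eq_continuous_at)
      ultimately show ?case
        using elim(1,2) by (intro tendsto_mult isCont_tendsto_compose[of _ g] tendsto_intros) auto
    qed
    show "AE \<omega> in M. norm (g ((x - Y \<omega> * vN N \<omega>) / uN N \<omega>) * (1 / \<bar>uN N \<omega>\<bar>)) \<le> w \<omega>" for N
      using c(2)[of N] K[of N]
    proof eventually_elim
      case (elim \<omega>)
      let ?y = "(x - Y \<omega> * vN N \<omega>) / uN N \<omega>"
      have "(x - Y \<omega> * vN N \<omega>)\<^sup>2 \<le> 2 * x\<^sup>2 + 2 * (Y \<omega> * vN N \<omega>)\<^sup>2"
        using zero_le_power2[of "x + Y \<omega> * vN N \<omega>"] by (simp add: power2_eq_square algebra_simps)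
      also have "\<dots> \<le> 2 * x\<^sup>2 + 2 * K\<^sup>2 * (Y \<omega>)\<^sup>2"
      proof -
        have "(vN N \<omega>)\<^sup>2 \<le> K\<^sup>2" using elim(2) by (simp add: abs_le_square_iff[symmetric])
        from mult_right_mono[OF this, of "(Y \<omega>)\<^sup>2"] show ?thesis
          by (simp add: power_mult_distrib mult_ac)
      qed
      finally have num: "(x - Y \<omega> * vN N \<omega>)\<^sup>2 \<le> 2 * x\<^sup>2 + 2 * K\<^sup>2 * (Y \<omega>)\<^sup>2" .
      have den: "c\<^sup>2 \<le> (uN N \<omega>)\<^sup>2" using c(1) elim(1) by (simp add: abs_le_square_iff[symmetric])
      have "?y\<^sup>2 \<le> (2 * x\<^sup>2 + 2 * K\<^sup>2 * (Y \<omega>)\<^sup>2) / c\<^sup>2"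
        unfolding power_divide using num den c(1) by (intro frac_le) auto
      then have "g ?y \<le> \<alpha> + \<beta> * ((2 * x\<^sup>2 + 2 * K\<^sup>2 * (Y \<omega>)\<^sup>2) / c\<^sup>2)"
        using gle[of ?y] mult_left_mono[OF _ ab(2)] by fastforce
      moreover have "1 / \<bar>uN N \<omega>\<bar> \<le> 1 / c" using c(1) elim(1) by (intro divide_left_mono) auto
      ultimately have "g ?y * (1 / \<bar>uN N \<omega>\<bar>) \<le> w \<omega>"
        unfolding w_def using g0[of ?y] by (intro mult_mono) auto
      then show ?case using g0[of ?y] by (simp add: abs_mult)
    qed
  qed measurable
qed

theorem theorem3p6:
  fixes M :: "'a measure"
    and A B :: "nat \<Rightarrow> 'a \<Rightarrow> real"
    and Y0 Y1 :: "'a \<Rightarrow> real"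
    and fY0 :: "real \<Rightarrow> real"
    and t0 r \<delta> \<alpha> \<beta> :: real
  assumes "prob_space M"
    and "complete_measure M"
    and "r > 0"
    and "Linf_power_series M A t0 r"
    and "Linf_power_series M B t0 r"
    and "Y0 \<in> L2 M"
    and "Y1 \<in> L2 M"
    and "\<And>y. 0 \<le> fY0 y"
    and "distributed M lborel Y0 (\<lambda>y. ennreal (fY0 y))"
    and "indep_rv M borel Y0
           (borel \<Otimes>\<^sub>M (Pi\<^sub>M UNIV (\<lambda>_. borel) \<Otimes>\<^sub>M Pi\<^sub>M UNIV (\<lambda>_. borel)))
           (\<lambda>\<omega>. (Y1 \<omega>, (\<lambda>n. A n \<omega>), (\<lambda>n. B n \<omega>)))"
    and "continuous_on UNIV fY0"
    and "\<alpha> \<ge> 0"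
    and "\<beta> \<ge> 0"
    and "\<And>y. fY0 y \<le> \<alpha> + \<beta> * y\<^sup>2"
    and "0 < \<delta>"
    and "\<delta> \<le> r"
    and "\<And>t. t \<in> {t0 - \<delta><..<t0 + \<delta>} \<Longrightarrow>
           Linf_norm M (\<lambda>\<omega>. S_series M A B 1 0 t0 t \<omega> - 1) < ereal (1 / 4)"
  shows "\<forall>t\<in>{t0 - \<delta><..<t0 + \<delta>}. \<forall>x.
           (\<lambda>N. density_XN M A B fY0 Y1 t0 N t x) \<longlonglongrightarrow> density_X M A B fY0 Y1 t0 t x"
proof (intro ballI allI)
  fix t x :: real assume t: "t \<in> {t0 - \<delta><..<t0 + \<delta>}"
  interpret prob_space M by fact
  define s where "s c0 c1 = S_series M A B c0 c1 t0 t" for c0 c1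
  define sN where "sN c0 c1 N = S_partial A B c0 c1 t0 N t" for c0 c1 N
  have [measurable]: "A n \<in> borel_measurable M" "B n \<in> borel_measurable M" for n
    using assms(4,5) by (auto simp: Linf_power_series_def Linf_def)
  have term_meas: "(\<lambda>\<omega>. S_coeff A B c0 c1 n \<omega> * (t - t0) ^ n) \<in> borel_measurable M" for c0 c1 n
    by measurable
  have sums: "Linf_sums M (\<lambda>n \<omega>. S_coeff A B c0 c1 n \<omega> * (t - t0) ^ n) (s c0 c1)" for c0 c1
    unfolding s_def using t assms(16) by (intro Linf_sums_S_series[OF assms(1,4,5)]) auto
  have s_Linf: "s c0 c1 \<in> Linf M" for c0 c1 using sums by (auto simp: Linf_sums_def)
  have [measurable]: "s c0 c1 \<in> borel_measurable M" for c0 c1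
    using s_Linf[of c0 c1] by (simp add: Linf_def)
  have [measurable]: "sN c0 c1 N \<in> borel_measurable M" for c0 c1 N
    unfolding sN_def S_partial_def[abs_def] by measurable
  have lim: "AE \<omega> in M. (\<lambda>N. sN c0 c1 N \<omega>) \<longlonglongrightarrow> s c0 c1 \<omega>" for c0 c1
    using Linf_sums_imp_AE_tendsto[OF assms(1) term_meas sums] by (simp add: sN_def S_partial_def)
  have unif: "\<exists>N0. AE \<omega> in M. \<forall>N\<ge>N0. \<bar>sN c0 c1 N \<omega> - s c0 c1 \<omega>\<bar> \<le> 1 / 4" for c0 c1
    using sums[of c0 c1] unfolding Linf_sums_iff_uniform_AE[OF assms(1) term_meas] sN_def S_partial_def
    by (elim conjE allE[of _ "1 / 4"] impE) simp_all
  obtain N0 where N0: "AE \<omega> in M. \<forall>N\<ge>N0. \<bar>sN 1 0 N \<omega> - s 1 0 \<omega>\<bar> \<le> 1 / 4" using unif by blast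
  obtain N1 where N1: "AE \<omega> in M. \<forall>N\<ge>N1. \<bar>sN 0 1 N \<omega> - s 0 1 \<omega>\<bar> \<le> 1 / 4" using unif by blast
  define N' where "N' = max N0 N1"
  obtain K where K: "AE \<omega> in M. \<bar>s 0 1 \<omega>\<bar> \<le> K" using Linf_bounded[OF s_Linf] .
  \<comment> \<open>With error \<open>1/4\<close> here and \<open>1/4\<close> for the partial sums, the latter stay above \<open>1/2\<close>.\<close>
  have near1: "AE \<omega> in M. \<bar>s 1 0 \<omega> - 1\<bar> \<le> 1 / 4"
    unfolding s_def by (rule AE_le_of_Linf_norm_le[OF less_imp_le[OF assms(17)[OF t]]])
  have "(\<lambda>N. lin_comb_density M fY0 Y1 (sN 1 0 (N + N')) (sN 0 1 (N + N')) x)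
      \<longlonglongrightarrow> lin_comb_density M fY0 Y1 (s 1 0) (s 0 1) x"
  proof (rule lin_comb_density_tendsto[where c = "1/2" and K = "K + 1/4", OF _ assms(7,11,8,14,12,13)])
    show "AE \<omega> in M. (\<lambda>N. sN 1 0 (N + N') \<omega>) \<longlonglongrightarrow> s 1 0 \<omega>"
      using lim[of 1 0] by eventually_elim (rule LIMSEQ_ignore_initial_segment)
    show "AE \<omega> in M. (\<lambda>N. sN 0 1 (N + N') \<omega>) \<longlonglongrightarrow> s 0 1 \<omega>"
      using lim[of 0 1] by eventually_elim (rule LIMSEQ_ignore_initial_segment)
    show "AE \<omega> in M. 1/2 \<le> \<bar>sN 1 0 (N + N') \<omega>\<bar>" for N
      using N0 near1
    proof eventually_elim
      case (elim \<omega>)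
      have "\<bar>sN 1 0 (N + N') \<omega> - s 1 0 \<omega>\<bar> \<le> 1 / 4" using elim(1) by (simp add: N'_def)
      then show ?case using elim(2) by linarith
    qed
    show "AE \<omega> in M. \<bar>sN 0 1 (N + N') \<omega>\<bar> \<le> K + 1/4" for N
      using N1 K
    proof eventually_elim
      case (elim \<omega>)
      have "\<bar>sN 0 1 (N + N') \<omega> - s 0 1 \<omega>\<bar> \<le> 1 / 4" using elim(1) by (simp add: N'_def)
      then show ?case using elim(2) by linarith
    qed
  qed (simp_all add: finite_measure_axioms)
  then show "(\<lambda>N. density_XN M A B fY0 Y1 t0 N t x) \<longlonglongrightarrow> density_X M A B fY0 Y1 t0 t x"
    unfolding density_XN_def density_X_def s_def[symmetric] sN_def[symmetric]
    by (rule LIMSEQ_offset)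
qed

end
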